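(* Let $\Bbbk$ be a field, let $S=\Bbbk[X]$ be a polynomial ring in a finite set of variables $X$ partitioned as $X = X_1\cup\cdots\cup X_r$ (variables of $r$ colors), with the $\mathbb{N}^r$-grading in which each variable in $X_i$ has multidegree $e_i$. Let $d$ be an integer and let $I\subseteq S$ be a $(d+1)$-regular ideal which is homogeneous for the $\mathbb{N}^r$-grading. Suppose that for each $i=1,\ldots,r$ the ideal $I$ contains an element of pure color $i$. Then for each color vector $(a_1,\ldots,a_r)\in\mathbb{N}^r$ with $\sum_{i=1}^r a_i = d+1$, there exists an element of $I$ with this color vector.
   Context: $\mathbb{N}$ denotes the nonnegative integers and $e_i\in\mathbb{N}^r$ is the $i$-th unit coordinate vector. A nonzero polynomial which is homogeneous for the $\mathbb{N}^r$-grading of multidegree $\mathbf{a}=(a_1,\ldots,a_r)$ is said to have color vector $(a_1,\ldots,a_r)$. A nonzero homogeneous polynomial with color vector $r_i e_i$, where $r_i$ is a positive integer, is said to have pure color $i$. Regularity: let $F_\bullet$ be a minimal graded free resolution of $I$ (for the standard total-degree grading) with terms $F_p=\bigoplus_{i\in\mathbb{Z}} S(-i)^{\beta_{p,i}}$. The ideal $I$ is $m$-regular if $i\le m+p$ for every nonzero $\beta_{p,i}$. *)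

theory Defs
  imports Complex_Main "HOL-Library.Poly_Mapping"
begin

text \<open>The polynomial ring over \<open>'k\<close> whose set of variables is the (finite) type \<open>'x\<close>.\<close>

type_synonym ('x, 'k) mpoly = "('x \<Rightarrow>\<^sub>0 nat) \<Rightarrow>\<^sub>0 'k"

definition is_ideal :: "('x, 'k::comm_ring_1) mpoly set \<Rightarrow> bool"
  where "is_ideal I \<longleftrightarrow> module.subspace (*) I"


section \<open>The grading by colors\<close>

text \<open>A partition of the variables into colors is given by the map \<open>c\<close> sending a variable to its
  color: the part of color \<open>i\<close> is \<open>{x. c x = i}\<close>. A vector in \<open>\<nat>\<^sup>r\<close> is a function from the type
  \<open>'c\<close> of colors to \<^typ>\<open>nat\<close>.\<close>

definition multidegree :: "('x::finite \<Rightarrow> 'c) \<Rightarrow> ('x \<Rightarrow>\<^sub>0 nat) \<Rightarrow> 'c \<Rightarrow> nat"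
  where "multidegree c t i = (\<Sum>x | c x = i. Poly_Mapping.lookup t x)"

definition multigraded_component ::
    "('x::finite \<Rightarrow> 'c) \<Rightarrow> ('c \<Rightarrow> nat) \<Rightarrow> ('x, 'k::comm_ring_1) mpoly \<Rightarrow> ('x, 'k) mpoly"
  where "multigraded_component c a f =
    Poly_Mapping.mapp (\<lambda>t s. if multidegree c t = a then s else 0) f"

definition multihomogeneous_ideal ::
    "('x::finite \<Rightarrow> 'c) \<Rightarrow> ('x, 'k::comm_ring_1) mpoly set \<Rightarrow> bool"
  where "multihomogeneous_ideal c I \<longleftrightarrow>
    is_ideal I \<and> (\<forall>f\<in>I. \<forall>a. multigraded_component c a f \<in> I)"

definition has_color_vector ::
    "('x::finite \<Rightarrow> 'c) \<Rightarrow> ('x, 'k::comm_ring_1) mpoly \<Rightarrow> ('c \<Rightarrow> nat) \<Rightarrow> bool"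
  where "has_color_vector c f a \<longleftrightarrow> f \<noteq> 0 \<and> (\<forall>t\<in>Poly_Mapping.keys f. multidegree c t = a)"

definition has_pure_color ::
    "('x::finite \<Rightarrow> 'c) \<Rightarrow> ('x, 'k::comm_ring_1) mpoly \<Rightarrow> 'c \<Rightarrow> bool"
  where "has_pure_color c f i \<longleftrightarrow>
    (\<exists>n>0. has_color_vector c f (\<lambda>j. if j = i then n else 0))"


section \<open>Graded free modules and minimal graded free resolutions\<close>

definition total_degree :: "('x::finite \<Rightarrow>\<^sub>0 nat) \<Rightarrow> nat"
  where "total_degree t = (\<Sum>x\<in>UNIV. Poly_Mapping.lookup t x)"

text \<open>\<open>homogeneous_part e\<close> is \<open>S\<^sub>e\<close>; it is zero for \<open>e < 0\<close>.\<close>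

definition homogeneous_part :: "int \<Rightarrow> ('x::finite, 'k::comm_ring_1) mpoly set"
  where "homogeneous_part e = {f. \<forall>t\<in>Poly_Mapping.keys f. int (total_degree t) = e}"

text \<open>The homogeneous maximal ideal, generated by the variables.\<close>

definition irrelevant_ideal :: "('x, 'k::comm_ring_1) mpoly set"
  where "irrelevant_ideal = {f. Poly_Mapping.lookup f 0 = 0}"

text \<open>Elements of the free module \<open>\<Oplus>\<^sub>i S(-i)\<^bsup>\<beta> i\<^esup>\<close> are finitely supported families of polynomials
  whose indices are the pairs \<open>(i, k)\<close> with \<open>k < \<beta> i\<close>; the basis vector with index \<open>(i, k)\<close> has
  degree \<open>i\<close>.\<close>

type_synonym ('x, 'k) fvec = "(int \<times> nat) \<Rightarrow>\<^sub>0 ('x, 'k) mpoly"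

definition free_module :: "(int \<Rightarrow> nat) \<Rightarrow> ('x, 'k::comm_ring_1) fvec set"
  where "free_module \<beta> = {v. \<forall>(i, k)\<in>Poly_Mapping.keys v. k < \<beta> i}"

definition fscale :: "('x, 'k::comm_ring_1) mpoly \<Rightarrow> ('x, 'k) fvec \<Rightarrow> ('x, 'k) fvec"
  where "fscale s v = Poly_Mapping.map ((*) s) v"

text \<open>The degree \<open>e\<close> part of \<open>S(-i)\<close> is \<open>S\<^bsub>e - i\<^esub>\<close>.\<close>

definition free_module_part ::
    "(int \<Rightarrow> nat) \<Rightarrow> int \<Rightarrow> ('x::finite, 'k::comm_ring_1) fvec set"
  where "free_module_part \<beta> e =
    {v \<in> free_module \<beta>. \<forall>i k. Poly_Mapping.lookup v (i, k) \<in> homogeneous_part (e - i)}"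

text \<open>The submodule \<open>\<mm>F\<close> of a free module \<open>F\<close>, where \<open>\<mm>\<close> is the homogeneous maximal ideal.\<close>

definition irrelevant_submodule :: "(int \<Rightarrow> nat) \<Rightarrow> ('x, 'k::comm_ring_1) fvec set"
  where "irrelevant_submodule \<beta> =
    {v \<in> free_module \<beta>. \<forall>b. Poly_Mapping.lookup v b \<in> irrelevant_ideal}"

definition linear_on_free ::
    "(('x, 'k) mpoly \<Rightarrow> 'm \<Rightarrow> 'm) \<Rightarrow> (int \<Rightarrow> nat) \<Rightarrow>
     (('x, 'k::comm_ring_1) fvec \<Rightarrow> 'm::ab_group_add) \<Rightarrow> bool"
  where "linear_on_free scale \<beta> h \<longleftrightarrow>
    (\<forall>v\<in>free_module \<beta>. \<forall>w\<in>free_module \<beta>. h (v + w) = h v + h w) \<and>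
    (\<forall>s. \<forall>v\<in>free_module \<beta>. h (fscale s v) = scale s (h v))"

text \<open>The complex \<open>\<cdots> \<rightarrow> F\<^sub>2 \<rightarrow> F\<^sub>1 \<rightarrow> F\<^sub>0 \<rightarrow> I \<rightarrow> 0\<close>, where \<open>F\<^sub>p = \<Oplus>\<^sub>i S(-i)\<^bsup>\<beta> p i\<^esup>\<close> has finite rank,
  with augmentation \<open>\<epsilon> : F\<^sub>0 \<rightarrow> I\<close> and differentials \<open>\<phi> p : F\<^bsub>p+1\<^esub> \<rightarrow> F\<^sub>p\<close>. All maps preserve degrees,
  the augmented complex is exact, and it is minimal: the image of \<open>\<phi> p\<close> lies in \<open>\<mm>F\<^sub>p\<close>.\<close>

definition minimal_graded_free_resolution ::
    "('x::finite, 'k::field) mpoly set \<Rightarrow> (nat \<Rightarrow> int \<Rightarrow> nat) \<Rightarrow>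
     (('x, 'k) fvec \<Rightarrow> ('x, 'k) mpoly) \<Rightarrow> (nat \<Rightarrow> ('x, 'k) fvec \<Rightarrow> ('x, 'k) fvec) \<Rightarrow> bool"
  where "minimal_graded_free_resolution I \<beta> \<epsilon> \<phi> \<longleftrightarrow>
    (\<forall>p. finite {i. \<beta> p i \<noteq> 0}) \<and>
    linear_on_free (*) (\<beta> 0) \<epsilon> \<and>
    (\<forall>p. linear_on_free fscale (\<beta> (Suc p)) (\<phi> p)) \<and>
    (\<forall>e. \<epsilon> ` free_module_part (\<beta> 0) e \<subseteq> homogeneous_part e) \<and>
    (\<forall>p e. \<phi> p ` free_module_part (\<beta> (Suc p)) e \<subseteq> free_module_part (\<beta> p) e) \<and>
    \<epsilon> ` free_module (\<beta> 0) = I \<and>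
    \<phi> 0 ` free_module (\<beta> 1) = {v \<in> free_module (\<beta> 0). \<epsilon> v = 0} \<and>
    (\<forall>p. \<phi> (Suc p) ` free_module (\<beta> (Suc (Suc p))) =
      {v \<in> free_module (\<beta> (Suc p)). \<phi> p v = 0}) \<and>
    (\<forall>p. \<phi> p ` free_module (\<beta> (Suc p)) \<subseteq> irrelevant_submodule (\<beta> p))"

text \<open>A minimal graded free resolution of a homogeneous ideal exists and is unique up to
  isomorphism, so the numbers \<open>\<beta> p i\<close> do not depend on the choice of the resolution.\<close>

definition regular_ideal :: "int \<Rightarrow> ('x::finite, 'k::field) mpoly set \<Rightarrow> bool"
  where "regular_ideal m I \<longleftrightarrow>
    (\<exists>\<beta> \<epsilon> \<phi>. minimal_graded_free_resolution I \<beta> \<epsilon> \<phi> \<and>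
      (\<forall>p i. \<beta> p i \<noteq> 0 \<longrightarrow> i \<le> m + int p))"

end

theory Submission
  imports Defs
begin

text \<open>Suppose that \<open>I\<close> has no element with color vector \<open>a\<close>. Multiplying by variables, it has none
  with a color vector \<open>\<le> a\<close> either, so \<open>I\<close> lies in the monomial ideal \<open>P\<^sub>1 + \<cdots> + P\<^sub>r\<close>, where
  \<open>P\<^sub>i\<close> is spanned by the monomials of degree \<open>> a\<^sub>i\<close> in color \<open>i\<close>; that is, by those in
  \<open>exceeding c a i\<close>. The intersection \<open>P\<^sub>1 \<inter> \<cdots> \<inter> P\<^sub>r\<close> starts in total degree
  \<open>a\<^sub>1 + \<cdots> + a\<^sub>r + r = d + 1 + r\<close>, whereas regularity bounds the degrees of the generators of
  \<open>F\<^bsub>r-1\<^esub>\<close> by \<open>d + r\<close>. Hence every homogeneous map \<open>F\<^bsub>r-1\<^esub> \<rightarrow> P\<^sub>1 \<inter> \<cdots> \<inter> P\<^sub>r\<close> vanishes, and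
  it is enough to construct a nonzero one.

  The Mayer-Vietoris sequences \<open>0 \<rightarrow> P \<inter> N \<rightarrow> P \<oplus> N \<rightarrow> P + N \<rightarrow> 0\<close> provide it. For monomial ideals
  \<open>P\<close> and \<open>N\<close>, a cocycle \<open>\<psi> : F\<^sub>p \<rightarrow> P + N\<close> splits on the free module \<open>F\<^sub>p\<close> as
  \<open>\<psi> = \<alpha> + (\<psi> - \<alpha>)\<close> with \<open>\<alpha>\<close> into \<open>P\<close> and \<open>\<psi> - \<alpha>\<close> into \<open>N\<close>, and \<open>\<alpha> \<circ> \<phi> p\<close> is a cocycle
  \<open>F\<^bsub>p+1\<^esub> \<rightarrow> P \<inter> N\<close> (\<open>graded_cocycle_connecting\<close>). Starting with the augmentation \<open>F\<^sub>0 \<rightarrow> I\<close> and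
  treating one color at a time, after the colors of a list \<open>T\<close> there is a cocycle on
  \<open>F\<^bsub>|T|\<^esub>\<close> with values in the intersection of the \<open>P\<^sub>i\<close> for \<open>i \<in> T\<close> and of the sum of the other
  \<open>P\<^sub>i\<close>. After all colors but one this is the intersection of all \<open>P\<^sub>i\<close>, and the degree is \<open>r - 1\<close>.

  That the cocycle is nonzero is seen by evaluating it on a lift of the Koszul complex of the pure
  elements \<open>f\<^sub>1, \<dots>, f\<^sub>r \<in> I\<close> to the resolution. Call \<open>u (i # T) \<in> F\<^bsub>|T|\<^esub>\<close> the lift of the
  Koszul basis element of \<open>i # T\<close>. The invariant of the induction (\<open>detects\<close>) is that, in the color
  vector of \<open>f\<^sub>i \<cdot> (\<Prod>j\<in>T. f\<^sub>j)\<close>, the cocycle takes exactly this product as its value on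
  \<open>u (i # T)\<close>. All unwanted terms vanish for reasons of multidegree: an element of \<open>P\<^sub>j\<close> has no
  component of degree \<open>0\<close> in color \<open>j\<close> (\<open>koszul_component_eq_0\<close>, \<open>detects_connecting\<close>). The
  product is nonzero since its factors involve disjoint sets of variables. In this way the
  resolution needs only its total grading; the color grading is read off from the values.\<close>

section \<open>Supports of polynomials and graded components\<close>

lemma keys_mult_memE:
  assumes "t \<in> Poly_Mapping.keys (g * h)"
  obtains s s' where "s \<in> Poly_Mapping.keys g" "s' \<in> Poly_Mapping.keys h" "t = s + s'"
  using assms keys_mult[of g h] by blast

text \<open>The upward closed sets of monomials are the monomial ideals: \<open>M\<close> stands for the ideal of all
  \<open>g\<close> with \<open>keys g \<subseteq> M\<close>. Intersections and sums of ideals are then intersections and unions.\<close>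

definition upward_closed :: "'m::monoid_add set \<Rightarrow> bool"
  where "upward_closed M \<longleftrightarrow> (\<forall>s. \<forall>t\<in>M. s + t \<in> M)"

lemma keys_mult_upward_closed:
  assumes "upward_closed M" "Poly_Mapping.keys h \<subseteq> M"
  shows "Poly_Mapping.keys (g * h) \<subseteq> M"
  using assms by (fastforce elim!: keys_mult_memE simp: upward_closed_def)

lemma lookup_mult_unique_factorization:
  fixes g h :: "'m::cancel_comm_monoid_add \<Rightarrow>\<^sub>0 'k::comm_ring_1"
  assumes unique: "\<And>s' t'. s' \<in> Poly_Mapping.keys g \<Longrightarrow> t' \<in> Poly_Mapping.keys h \<Longrightarrow>
    s' + t' = s + t \<Longrightarrow> s' = s \<and> t' = t"
  shows "Poly_Mapping.lookup (g * h) (s + t) = Poly_Mapping.lookup g s * Poly_Mapping.lookup h t"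
proof -
  define g' where "g' = g - Poly_Mapping.single s (Poly_Mapping.lookup g s)"
  define h' where "h' = h - Poly_Mapping.single t (Poly_Mapping.lookup h t)"
  have g': "s' \<in> Poly_Mapping.keys g \<and> s' \<noteq> s" if "s' \<in> Poly_Mapping.keys g'" for s'
    using that by (cases "s' = s") (auto simp: g'_def in_keys_iff lookup_minus lookup_single)
  have h': "t' \<in> Poly_Mapping.keys h \<and> t' \<noteq> t" if "t' \<in> Poly_Mapping.keys h'" for t'
    using that by (cases "t' = t") (auto simp: h'_def in_keys_iff lookup_minus lookup_single)
  have "g * h = Poly_Mapping.single (s + t) (Poly_Mapping.lookup g s * Poly_Mapping.lookup h t)
      + (Poly_Mapping.single s (Poly_Mapping.lookup g s) * h' + g' * h)"
    by (simp add: g'_def h'_def mult_single algebra_simps)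
  moreover have "s + t \<notin> Poly_Mapping.keys (g' * h)"
    using unique g' by (fastforce elim!: keys_mult_memE)
  moreover have "s + t \<notin> Poly_Mapping.keys (Poly_Mapping.single s (Poly_Mapping.lookup g s) * h')"
    using h' by (fastforce elim!: keys_mult_memE split: if_splits)
  ultimately show ?thesis
    by (simp add: lookup_add in_keys_iff)
qed

lemma multidegree_add: "multidegree c (s + t) i = multidegree c s i + multidegree c t i"
  by (simp add: multidegree_def lookup_add sum.distrib)

lemma multidegree_eq_0_iff:
  "multidegree c t i = 0 \<longleftrightarrow> (\<forall>x. c x = i \<longrightarrow> Poly_Mapping.lookup t x = 0)"
  by (auto simp: multidegree_def)

lemma total_degree_add: "total_degree (s + t) = total_degree s + total_degree t"
  by (simp add: total_degree_def lookup_add sum.distrib)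

lemma total_degree_eq_sum_multidegree:
  fixes c :: "'x::finite \<Rightarrow> 'c::finite"
  shows "total_degree t = (\<Sum>i\<in>UNIV. multidegree c t i)"
  using sum.group[of "UNIV :: 'x set" "UNIV :: 'c set" c "Poly_Mapping.lookup t"]
  by (simp add: total_degree_def multidegree_def)

lemma lookup_multigraded_component:
  "Poly_Mapping.lookup (multigraded_component c b g) t =
    (if multidegree c t = b then Poly_Mapping.lookup g t else 0)"
  by (auto simp: multigraded_component_def lookup_mapp in_keys_iff when_def)

lemma keys_multigraded_component:
  "Poly_Mapping.keys (multigraded_component c b g) =
    {t \<in> Poly_Mapping.keys g. multidegree c t = b}"
  by (auto simp: in_keys_iff lookup_multigraded_component split: if_splits)

lemma multigraded_component_diff:
  "multigraded_component c b (g - h) = multigraded_component c b g - multigraded_component c b h"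
  by (rule poly_mapping_eqI) (simp add: lookup_multigraded_component lookup_minus)

lemma multigraded_component_add:
  "multigraded_component c b (g + h) = multigraded_component c b g + multigraded_component c b h"
  by (rule poly_mapping_eqI) (simp add: lookup_multigraded_component lookup_add)

lemma multigraded_component_eq_0:
  assumes "\<And>t. t \<in> Poly_Mapping.keys g \<Longrightarrow> multidegree c t \<noteq> b"
  shows "multigraded_component c b g = 0"
  using assms by (intro poly_mapping_eqI) (auto simp: lookup_multigraded_component in_keys_iff)

lemma multigraded_component_eq_self:
  assumes "\<And>t. t \<in> Poly_Mapping.keys g \<Longrightarrow> multidegree c t = b"
  shows "multigraded_component c b g = g"
  using assms by (intro poly_mapping_eqI) (auto simp: lookup_multigraded_component in_keys_iff)

text \<open>Only the component of \<open>h\<close> in the complementary multidegree can contribute.\<close>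

lemma multigraded_component_mult:
  assumes g: "\<And>t. t \<in> Poly_Mapping.keys g \<Longrightarrow> multidegree c t = b"
    and b': "\<And>i. b' i = b i + b'' i"
  shows "multigraded_component c b' (g * h) = g * multigraded_component c b'' h"
proof -
  define h'' where "h'' = multigraded_component c b'' h"
  have keys'': "multidegree c t \<noteq> b''" if "t \<in> Poly_Mapping.keys (h - h'')" for t
    using that by (auto simp: h''_def in_keys_iff lookup_minus lookup_multigraded_component)
  have "multigraded_component c b' (g * (h - h'')) = 0"
  proof (rule multigraded_component_eq_0)
    fix t assume "t \<in> Poly_Mapping.keys (g * (h - h''))"
    then obtain s s' where s: "s \<in> Poly_Mapping.keys g" "s' \<in> Poly_Mapping.keys (h - h'')"
      "t = s + s'"
      by (rule keys_mult_memE)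
    show "multidegree c t \<noteq> b'"
    proof
      assume "multidegree c t = b'"
      then have "multidegree c s' = b''"
        using s g[of s] b' by (auto simp: fun_eq_iff multidegree_add)
      then show False using keys'' s by blast
    qed
  qed
  moreover have "multigraded_component c b' (g * h'') = g * h''"
    using g b' by (intro multigraded_component_eq_self)
      (auto elim!: keys_mult_memE simp: h''_def keys_multigraded_component multidegree_add fun_eq_iff)
  moreover have "g * h = g * h'' + g * (h - h'')"
    by (simp add: algebra_simps)
  ultimately show ?thesis
    by (simp add: multigraded_component_add h''_def)
qed

lemma homogeneous_part_mult:
  assumes "g \<in> homogeneous_part e" "h \<in> homogeneous_part e'"
  shows "g * h \<in> homogeneous_part (e + e')"
  using assms by (auto simp: homogeneous_part_def total_degree_add elim!: keys_mult_memE)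

lemma homogeneous_part_sum:
  assumes "\<And>b. b \<in> B \<Longrightarrow> g b \<in> homogeneous_part e"
  shows "(\<Sum>b\<in>B. g b) \<in> homogeneous_part e"
  using assms keys_sum[of g B] by (fastforce simp: homogeneous_part_def)

section \<open>Linear maps on graded free modules\<close>

lemma lookup_fscale [simp]: "Poly_Mapping.lookup (fscale s v) b = s * Poly_Mapping.lookup v b"
  by (simp add: fscale_def map.rep_eq when_def)

lemma module_fscale: "module (fscale :: ('x, 'k::comm_ring_1) mpoly \<Rightarrow> _)"
  by unfold_locales (auto intro!: poly_mapping_eqI simp: lookup_add algebra_simps)

lemma module_times: "module ((*) :: 'r::comm_ring_1 \<Rightarrow> _)"
  by unfold_locales (simp_all add: algebra_simps)

lemma free_module_zero: "0 \<in> free_module \<beta>"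
  by (simp add: free_module_def)

lemma free_module_add: "v \<in> free_module \<beta> \<Longrightarrow> w \<in> free_module \<beta> \<Longrightarrow> v + w \<in> free_module \<beta>"
  using keys_add[of v w] by (fastforce simp: free_module_def)

lemma free_module_diff: "v \<in> free_module \<beta> \<Longrightarrow> w \<in> free_module \<beta> \<Longrightarrow> v - w \<in> free_module \<beta>"
  using keys_diff[of v w] by (fastforce simp: free_module_def)

lemma free_module_fscale: "v \<in> free_module \<beta> \<Longrightarrow> fscale s v \<in> free_module \<beta>"
  by (fastforce simp: free_module_def in_keys_iff)

lemma free_module_single: "k < \<beta> i \<Longrightarrow> Poly_Mapping.single (i, k) s \<in> free_module \<beta>"
  by (simp add: free_module_def)

lemma linear_on_free_diff:
  assumes "module scale" "linear_on_free scale \<beta> h" "v \<in> free_module \<beta>" "w \<in> free_module \<beta>"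
  shows "h (v - w) = h v - h w"
proof -
  have "h (v - w + w) = h (v - w) + h w"
    using assms free_module_diff unfolding linear_on_free_def by blast
  then show ?thesis by simp
qed

lemma linear_on_free_zero:
  assumes "module scale" "linear_on_free scale \<beta> h"
  shows "h 0 = 0"
  using linear_on_free_diff[OF assms free_module_zero free_module_zero] by simp

lemma linear_on_free_compose:
  assumes "linear_on_free fscale \<beta>' g" "linear_on_free scale \<beta> h"
    and "g ` free_module \<beta>' \<subseteq> free_module \<beta>"
  shows "linear_on_free scale \<beta>' (h \<circ> g)"
  using assms by (auto simp: linear_on_free_def image_subset_iff)

text \<open>The linear map with prescribed values \<open>\<theta>\<close> on the basis vectors.\<close>

definition basis_extension ::
    "(int \<times> nat \<Rightarrow> ('x, 'k::comm_ring_1) mpoly) \<Rightarrow> ('x, 'k) fvec \<Rightarrow> ('x, 'k) mpoly"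
  where "basis_extension \<theta> v =
    (\<Sum>b\<in>Poly_Mapping.keys v. Poly_Mapping.lookup v b * \<theta> b)"

lemma basis_extension_superset:
  assumes "finite B" "Poly_Mapping.keys v \<subseteq> B"
  shows "basis_extension \<theta> v = (\<Sum>b\<in>B. Poly_Mapping.lookup v b * \<theta> b)"
  unfolding basis_extension_def using assms
  by (intro sum.mono_neutral_left) (auto simp: in_keys_iff)

lemma basis_extension_linear: "linear_on_free (*) \<beta> (basis_extension \<theta>)"
  unfolding linear_on_free_def
proof (intro conjI ballI allI)
  fix v w :: "('a, 'b) fvec" and s
  define B where "B = Poly_Mapping.keys v \<union> Poly_Mapping.keys w"
  have B: "finite B" "Poly_Mapping.keys v \<subseteq> B" "Poly_Mapping.keys w \<subseteq> B"
    "Poly_Mapping.keys (v + w) \<subseteq> B"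
    using keys_add[of v w] by (auto simp: B_def)
  show "basis_extension \<theta> (v + w) = basis_extension \<theta> v + basis_extension \<theta> w"
    using B by (simp add: basis_extension_superset[of B] lookup_add distrib_right sum.distrib)
  have keys_scale: "Poly_Mapping.keys (fscale s v) \<subseteq> Poly_Mapping.keys v"
    by (auto simp: in_keys_iff)
  show "basis_extension \<theta> (fscale s v) = s * basis_extension \<theta> v"
    using basis_extension_superset[OF finite_keys keys_scale, of \<theta>]
    by (simp add: basis_extension_def sum_distrib_left mult.assoc)
qed

lemma linear_on_free_eq_basis_extension:
  fixes v :: "('x, 'k::comm_ring_1) fvec"
  assumes h: "linear_on_free (*) \<beta> h" and v: "v \<in> free_module \<beta>"
  shows "h v = basis_extension (\<lambda>b. h (Poly_Mapping.single b 1)) v"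
proof -
  have h0: "h 0 = 0"
    by (rule linear_on_free_zero[OF module_times h])
  have single: "h (Poly_Mapping.single b s) = s * h (Poly_Mapping.single b 1)"
    if "b \<in> Poly_Mapping.keys v" for b s
  proof -
    have b: "Poly_Mapping.single b (1 :: ('x, 'k) mpoly) \<in> free_module \<beta>"
      using that v by (cases b) (auto simp: free_module_def)
    have "h (fscale s (Poly_Mapping.single b 1)) = s * h (Poly_Mapping.single b 1)"
      using h b unfolding linear_on_free_def by blast
    moreover
    have "Poly_Mapping.single b s = fscale s (Poly_Mapping.single b 1)"
      by (rule poly_mapping_eqI) (simp add: lookup_single when_def)
    ultimately show ?thesis by simp
  qed
  have *: "h (\<Sum>b\<in>B. Poly_Mapping.single b (Poly_Mapping.lookup v b)) =
      (\<Sum>b\<in>B. Poly_Mapping.lookup v b * h (Poly_Mapping.single b 1)) \<and>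
      (\<Sum>b\<in>B. Poly_Mapping.single b (Poly_Mapping.lookup v b)) \<in> free_module \<beta>"
    if "finite B" "B \<subseteq> Poly_Mapping.keys v" for B
    using that
  proof (induction B rule: finite_induct)
    case empty
    show ?case by (simp add: h0 free_module_zero)
  next
    case (insert b B)
    have "Poly_Mapping.single b s \<in> free_module \<beta>" for s :: "('x, 'k) mpoly"
      using insert.prems v by (cases b) (auto simp: free_module_def)
    then show ?case
      using insert h single[of b "Poly_Mapping.lookup v b"]
      by (simp add: linear_on_free_def free_module_add)
  qed
  have "(\<Sum>b\<in>Poly_Mapping.keys v. Poly_Mapping.single b (Poly_Mapping.lookup v b)) = v"
    by (rule poly_mapping_eqI)
      (auto simp: lookup_sum lookup_single when_def in_keys_iff)
  then show ?thesis
    using *[of "Poly_Mapping.keys v"] by (simp add: basis_extension_def)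
qed

lemma linear_on_free_eq_0:
  assumes "linear_on_free (*) \<beta> h" and "v \<in> free_module \<beta>"
    and "\<And>i k. k < \<beta> i \<Longrightarrow> h (Poly_Mapping.single (i, k) 1) = 0"
  shows "h v = 0"
  using assms(2,3) unfolding linear_on_free_eq_basis_extension[OF assms(1,2)] basis_extension_def
  by (intro sum.neutral) (auto simp: free_module_def)

lemma single_in_free_module_part:
  "k < \<beta> i \<Longrightarrow> Poly_Mapping.single (i, k) 1 \<in> free_module_part \<beta> i"
  by (auto simp: free_module_part_def free_module_single lookup_single when_def
      homogeneous_part_def total_degree_def)

definition restrict_support :: "'m set \<Rightarrow> ('m \<Rightarrow>\<^sub>0 'k::zero) \<Rightarrow> 'm \<Rightarrow>\<^sub>0 'k"
  where "restrict_support M = Poly_Mapping.mapp (\<lambda>t s. if t \<in> M then s else 0)"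

lemma lookup_restrict_support:
  "Poly_Mapping.lookup (restrict_support M g) t = (if t \<in> M then Poly_Mapping.lookup g t else 0)"
  by (auto simp: restrict_support_def lookup_mapp in_keys_iff when_def)

lemma keys_restrict_support: "Poly_Mapping.keys (restrict_support M g) = Poly_Mapping.keys g \<inter> M"
  by (auto simp: in_keys_iff lookup_restrict_support split: if_splits)

text \<open>The surjection from the direct sum of two monomial ideals onto their sum lets homogeneous maps
  from a free module lift. Cutting the values of \<open>\<psi>\<close> down to the monomials in \<open>P\<close> is not linear, so
  this is done on basis vectors only; ideals being closed under multiples, linear extension keeps
  the values of \<open>\<alpha>\<close> and of \<open>\<psi> - \<alpha>\<close> in the ideals of \<open>P\<close> and \<open>N\<close>.\<close>

lemma split_linear_map:
  fixes \<psi> :: "('x::finite, 'k::comm_ring_1) fvec \<Rightarrow> ('x, 'k) mpoly"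
  assumes lin: "linear_on_free (*) \<beta> \<psi>"
    and deg: "\<And>e. \<psi> ` free_module_part \<beta> e \<subseteq> homogeneous_part e"
    and supp: "\<And>v. v \<in> free_module \<beta> \<Longrightarrow> Poly_Mapping.keys (\<psi> v) \<subseteq> P \<union> N"
    and P: "upward_closed P" and N: "upward_closed N"
  obtains \<alpha> where "linear_on_free (*) \<beta> \<alpha>"
    and "\<And>e. \<alpha> ` free_module_part \<beta> e \<subseteq> homogeneous_part e"
    and "\<And>v. v \<in> free_module \<beta> \<Longrightarrow> Poly_Mapping.keys (\<alpha> v) \<subseteq> P"
    and "\<And>v. v \<in> free_module \<beta> \<Longrightarrow> Poly_Mapping.keys (\<psi> v - \<alpha> v) \<subseteq> N"
proof -
  define \<eta> where "\<eta> b = \<psi> (Poly_Mapping.single b 1)" for b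
  define \<theta> where "\<theta> b = restrict_support P (\<eta> b)" for b
  have sum_supp: "Poly_Mapping.keys (\<Sum>b\<in>B. Poly_Mapping.lookup v b * g b) \<subseteq> M"
    if "upward_closed M" "\<And>b. b \<in> B \<Longrightarrow> Poly_Mapping.keys (g b) \<subseteq> M" for M B g and v :: "('x, 'k) fvec"
  proof -
    have "Poly_Mapping.keys (\<Sum>b\<in>B. Poly_Mapping.lookup v b * g b) \<subseteq>
        (\<Union>b\<in>B. Poly_Mapping.keys (Poly_Mapping.lookup v b * g b))"
      by (rule keys_sum)
    then show ?thesis using that keys_mult_upward_closed by blast
  qed
  show ?thesis
  proof (rule that[of "basis_extension \<theta>"])
    show "linear_on_free (*) \<beta> (basis_extension \<theta>)"
      by (rule basis_extension_linear)
    show "basis_extension \<theta> ` free_module_part \<beta> e \<subseteq> homogeneous_part e" for e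
    proof
      fix g assume "g \<in> basis_extension \<theta> ` free_module_part \<beta> e"
      then obtain v where v: "v \<in> free_module_part \<beta> e" and g: "g = basis_extension \<theta> v"
        by blast
      show "g \<in> homogeneous_part e"
        unfolding g basis_extension_def
      proof (rule homogeneous_part_sum)
        fix b assume b: "b \<in> Poly_Mapping.keys v"
        obtain i k where ik: "b = (i, k)" by force
        have "k < \<beta> i"
          using v b ik by (auto simp: free_module_part_def free_module_def)
        then have "\<eta> b \<in> homogeneous_part i"
          using deg[of i] single_in_free_module_part[of k \<beta> i] by (auto simp: \<eta>_def ik)
        then have "\<theta> b \<in> homogeneous_part i"
          by (auto simp: \<theta>_def homogeneous_part_def keys_restrict_support)
        moreover have "Poly_Mapping.lookup v b \<in> homogeneous_part (e - i)"
          using v by (auto simp: free_module_part_def ik)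
        ultimately show "Poly_Mapping.lookup v b * \<theta> b \<in> homogeneous_part e"
          using homogeneous_part_mult by fastforce
      qed
    qed
    fix v :: "('x, 'k) fvec" assume v: "v \<in> free_module \<beta>"
    show "Poly_Mapping.keys (basis_extension \<theta> v) \<subseteq> P"
      unfolding basis_extension_def
      by (rule sum_supp[OF P]) (auto simp: \<theta>_def keys_restrict_support)
    have "\<psi> v - basis_extension \<theta> v =
        (\<Sum>b\<in>Poly_Mapping.keys v. Poly_Mapping.lookup v b * (\<eta> b - \<theta> b))"
      by (simp add: linear_on_free_eq_basis_extension[OF lin v] basis_extension_def \<eta>_def
          sum_subtractf algebra_simps)
    also have "Poly_Mapping.keys \<dots> \<subseteq> N"
    proof (rule sum_supp[OF N])
      fix b assume "b \<in> Poly_Mapping.keys v"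
      then have "Poly_Mapping.single b 1 \<in> free_module \<beta>"
        using v by (cases b) (auto simp: free_module_def)
      from supp[OF this] show "Poly_Mapping.keys (\<eta> b - \<theta> b) \<subseteq> N"
        by (auto simp: \<eta>_def \<theta>_def in_keys_iff lookup_minus lookup_restrict_support split: if_splits)
    qed
    finally show "Poly_Mapping.keys (\<psi> v - basis_extension \<theta> v) \<subseteq> N" .
  qed
qed

section \<open>Koszul differentials\<close>

text \<open>A family \<open>u\<close> indexed by lists of length \<open>m\<close> yields one indexed by lists of length \<open>m + 1\<close>, by
  \<open>(x\<^sub>0, \<dots>, x\<^sub>m) \<mapsto> \<Sum>\<^sub>j (-1)\<^sup>j f(x\<^sub>j) u(x\<^sub>0, \<dots>, x\<^bsub>j-1\<^esub>, x\<^bsub>j+1\<^esub>, \<dots>, x\<^sub>m)\<close>. If \<open>u\<close> sends a list to the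
  corresponding Koszul basis element, this is the Koszul differential. Using all lists instead of
  increasing ones gives a recursion in which the signs take care of themselves.\<close>

fun koszul :: "('r \<Rightarrow> 'm \<Rightarrow> 'm) \<Rightarrow> ('i \<Rightarrow> 'r) \<Rightarrow> ('i list \<Rightarrow> 'm::ab_group_add) \<Rightarrow> 'i list \<Rightarrow> 'm"
  where
    "koszul scale f u [] = 0"
  | "koszul scale f u (x # xs) = scale (f x) (u xs) - koszul scale f (\<lambda>ys. u (x # ys)) xs"

text \<open>Only lists shorter by one element enter; so facts about \<open>u\<close> are required for these only.\<close>

lemma koszul_cong:
  assumes "\<And>ys. Suc (length ys) = length xs \<Longrightarrow> u ys = v ys"
  shows "koszul scale f u xs = koszul scale f v xs"
  using assms
proof (induction xs arbitrary: u v)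
  case (Cons x xs)
  have "koszul scale f (\<lambda>ys. u (x # ys)) xs = koszul scale f (\<lambda>ys. v (x # ys)) xs"
    by (rule Cons.IH) (simp add: Cons.prems)
  then show ?case using Cons.prems by simp
qed simp

lemma koszul_diff:
  assumes "module scale"
  shows "koszul scale f (\<lambda>ys. u ys - v ys) xs = koszul scale f u xs - koszul scale f v xs"
  by (induction xs arbitrary: u v) (simp_all add: module.scale_right_diff_distrib[OF assms] algebra_simps)

lemma koszul_scale:
  assumes "module scale"
  shows "koszul scale f (\<lambda>ys. scale s (u ys)) xs = scale s (koszul scale f u xs)"
  by (induction xs arbitrary: u)
    (simp_all add: module.scale_right_diff_distrib[OF assms] module.scale_left_commute[OF assms]
      module.scale_zero_right[OF assms])

lemma koszul_koszul:
  assumes "module scale"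
  shows "koszul scale f (koszul scale f u) xs = 0"
  by (induction xs arbitrary: u) (simp_all add: koszul_diff[OF assms] koszul_scale[OF assms])

lemma koszul_in_free_module:
  assumes "\<And>ys. Suc (length ys) = length xs \<Longrightarrow> u ys \<in> free_module \<beta>"
  shows "koszul fscale f u xs \<in> free_module \<beta>"
  using assms
  by (induction xs arbitrary: u) (simp_all add: free_module_zero free_module_diff free_module_fscale)

lemma koszul_linear_on_free:
  assumes sc: "module scale" and h: "linear_on_free scale \<beta> h"
    and "\<And>ys. Suc (length ys) = length xs \<Longrightarrow> u ys \<in> free_module \<beta>"
  shows "h (koszul fscale f u xs) = koszul scale f (\<lambda>ys. h (u ys)) xs"
  using assms(3)
proof (induction xs arbitrary: u)
  case Nil
  show ?case by (simp add: linear_on_free_zero[OF sc h])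
next
  case (Cons x xs)
  have "h (fscale (f x) (u xs)) = scale (f x) (h (u xs))"
    using h Cons.prems by (simp add: linear_on_free_def)
  with Cons show ?case
    by (simp add: linear_on_free_diff[OF sc h] free_module_fscale koszul_in_free_module)
qed


section \<open>Polynomials of pure color\<close>

text \<open>A monomial in \<open>g\<close> and a monomial in \<open>h\<close> can be recovered from their product, as its parts in
  color \<open>i\<close> and in the other colors. So no cancellation occurs in \<open>g * h\<close>.\<close>

lemma mult_neq_0_if_colors_separate:
  fixes g h :: "('x::finite, 'k::field) mpoly"
  assumes "g \<noteq> 0" "h \<noteq> 0"
    and g: "\<And>t j. t \<in> Poly_Mapping.keys g \<Longrightarrow> j \<noteq> i \<Longrightarrow> multidegree c t j = 0"
    and h: "\<And>t. t \<in> Poly_Mapping.keys h \<Longrightarrow> multidegree c t i = 0"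
  shows "g * h \<noteq> 0"
proof -
  obtain s t where st: "s \<in> Poly_Mapping.keys g" "t \<in> Poly_Mapping.keys h"
    using assms(1,2) by (metis all_not_in_conv keys_eq_empty)
  have "Poly_Mapping.lookup (g * h) (s + t) = Poly_Mapping.lookup g s * Poly_Mapping.lookup h t"
  proof (rule lookup_mult_unique_factorization)
    fix s' t'
    assume s't': "s' \<in> Poly_Mapping.keys g" "t' \<in> Poly_Mapping.keys h" and eq: "s' + t' = s + t"
    have "Poly_Mapping.lookup s' x = Poly_Mapping.lookup s x" for x
    proof (cases "c x = i")
      case True
      then have "Poly_Mapping.lookup t x = 0" "Poly_Mapping.lookup t' x = 0"
        using h[OF st(2)] h[OF s't'(2)] by (simp_all add: multidegree_eq_0_iff)
      then show ?thesis
        using arg_cong[OF eq, of "\<lambda>m. Poly_Mapping.lookup m x"] by (simp add: lookup_add)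
    next
      case False
      then show ?thesis
        using g[OF st(1), of "c x"] g[OF s't'(1), of "c x"] by (simp add: multidegree_eq_0_iff)
    qed
    then have "s' = s"
      by (intro poly_mapping_eqI)
    with eq show "s' = s \<and> t' = t" by simp
  qed
  also have "\<dots> \<noteq> 0"
    using st by (simp add: in_keys_iff)
  finally show ?thesis by auto
qed

definition exceeding :: "('x::finite \<Rightarrow> 'c) \<Rightarrow> ('c \<Rightarrow> nat) \<Rightarrow> 'c \<Rightarrow> ('x \<Rightarrow>\<^sub>0 nat) set"
  where "exceeding c a i = {t. a i < multidegree c t i}"

lemma upward_closed_exceeding: "upward_closed (exceeding c a i)"
  by (auto simp: upward_closed_def exceeding_def multidegree_add)

lemma upward_closed_INT: "(\<And>i. i \<in> A \<Longrightarrow> upward_closed (M i)) \<Longrightarrow> upward_closed (\<Inter>i\<in>A. M i)"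
  by (auto simp: upward_closed_def)

lemma upward_closed_UN: "(\<And>i. i \<in> A \<Longrightarrow> upward_closed (M i)) \<Longrightarrow> upward_closed (\<Union>i\<in>A. M i)"
  by (auto simp: upward_closed_def)

lemma upward_closed_Int: "upward_closed M \<Longrightarrow> upward_closed N \<Longrightarrow> upward_closed (M \<inter> N)"
  by (auto simp: upward_closed_def)

text \<open>A monomial \<open>t\<close> of some \<open>g \<in> I\<close> outside all \<open>exceeding c a i\<close> has multidegree \<open>\<le> a\<close>. The
  component of \<open>g\<close> in that multidegree is in \<open>I\<close>, and a suitable monomial multiple of it has color
  vector \<open>a\<close>. Surjectivity of \<open>c\<close> supplies a variable of each color for that monomial.\<close>

lemma ideal_support_exceeds:
  fixes c :: "'x::finite \<Rightarrow> 'c::finite" and I :: "('x, 'k::field) mpoly set"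
  assumes I: "multihomogeneous_ideal c I" and surj: "surj c"
    and none: "\<not> (\<exists>g\<in>I. has_color_vector c g a)" and g: "g \<in> I"
  shows "Poly_Mapping.keys g \<subseteq> (\<Union>i. exceeding c a i)"
proof
  fix t assume t: "t \<in> Poly_Mapping.keys g"
  show "t \<in> (\<Union>i. exceeding c a i)"
  proof (rule ccontr)
    assume "t \<notin> (\<Union>i. exceeding c a i)"
    then have le: "multidegree c t i \<le> a i" for i
      by (auto simp: exceeding_def not_less)
    define h where "h = multigraded_component c (multidegree c t) g"
    have h: "h \<in> I" using I g by (auto simp: multihomogeneous_ideal_def h_def)
    have th: "t \<in> Poly_Mapping.keys h"
      using t by (simp add: h_def keys_multigraded_component)
    define x where "x i = inv c i" for i
    have cx: "c (x i) = i" for i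
      using surj by (simp add: x_def surj_f_inv_f)
    \<comment> \<open>a monomial of multidegree \<open>a - multidegree c t\<close>\<close>
    define m where "m = (\<Sum>i\<in>UNIV. Poly_Mapping.single (x i) (a i - multidegree c t i))"
    have "multidegree c m j = (\<Sum>i\<in>UNIV. multidegree c
        (Poly_Mapping.single (x i) (a i - multidegree c t i)) j)" for j
      unfolding m_def multidegree_def by (simp add: lookup_sum sum.swap[of _ UNIV])
    also have "\<dots> j = (\<Sum>i\<in>UNIV. if i = j then a i - multidegree c t i else 0)" for j
    proof (rule sum.cong)
      fix i
      show "multidegree c (Poly_Mapping.single (x i) (a i - multidegree c t i)) j =
          (if i = j then a i - multidegree c t i else 0)"
        using cx[of i] by (simp add: multidegree_def lookup_single when_def sum.delta)
    qed simp
    finally have m: "multidegree c m j = a j - multidegree c t j" for j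
      by simp
    define q where "q = Poly_Mapping.single m 1 * h"
    have "Poly_Mapping.lookup q (m + t) = 1 * Poly_Mapping.lookup h t"
      unfolding q_def
      by (subst lookup_mult_unique_factorization) (auto split: if_splits)
    then have "q \<noteq> 0" using th by (auto simp: in_keys_iff)
    moreover have "multidegree c s = a" if "s \<in> Poly_Mapping.keys q" for s
      using that le unfolding q_def
      by (auto elim!: keys_mult_memE simp: h_def keys_multigraded_component multidegree_add m
          fun_eq_iff split: if_splits)
    ultimately have "has_color_vector c q a"
      by (simp add: has_color_vector_def)
    moreover have "q \<in> I"
      using I h unfolding multihomogeneous_ideal_def is_ideal_def q_def
        module.subspace_def[OF module_times] by blast
    ultimately show False using none by blast
  qed
qed

section \<open>Pairing the resolution with the Koszul complex\<close>

text \<open>The situation to be refuted: a resolution of \<open>I \<subseteq> P\<^sub>1 + \<cdots> + P\<^sub>r\<close> together with nonzero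
  elements \<open>f i \<in> I\<close> of color vector \<open>n i\<close> times the unit vector of color \<open>i\<close>. These data
  force the resolution to have a generator of large degree (\<open>generator_of_large_degree\<close>), against
  the regularity of \<open>I\<close>.\<close>

locale colored_resolution =
  fixes c :: "'x::finite \<Rightarrow> 'c::finite" and a :: "'c \<Rightarrow> nat"
    and I :: "('x, 'k::field) mpoly set"
    and \<beta> :: "nat \<Rightarrow> int \<Rightarrow> nat"
    and \<epsilon> :: "('x, 'k) fvec \<Rightarrow> ('x, 'k) mpoly"
    and \<phi> :: "nat \<Rightarrow> ('x, 'k) fvec \<Rightarrow> ('x, 'k) fvec"
    and f :: "'c \<Rightarrow> ('x, 'k) mpoly" and n :: "'c \<Rightarrow> nat"
  assumes resolution: "minimal_graded_free_resolution I \<beta> \<epsilon> \<phi>"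
    and support_I: "\<And>g. g \<in> I \<Longrightarrow> Poly_Mapping.keys g \<subseteq> (\<Union>i. exceeding c a i)"
    and f_in_I: "\<And>i. f i \<in> I"
    and f_neq_0: "\<And>i. f i \<noteq> 0"
    and multidegree_f:
      "\<And>i t j. t \<in> Poly_Mapping.keys (f i) \<Longrightarrow> multidegree c t j = (if j = i then n i else 0)"
begin

definition joint_degree :: "'c list \<Rightarrow> 'c \<Rightarrow> nat"
  where "joint_degree T j = (if j \<in> set T then n j else 0)"

definition joint_product :: "'c list \<Rightarrow> ('x, 'k) mpoly"
  where "joint_product T = prod_list (map f T)"

lemma joint_product_Cons: "joint_product (i # T) = f i * joint_product T"
  by (simp add: joint_product_def)

lemma multidegree_joint_product:
  assumes "distinct T" "t \<in> Poly_Mapping.keys (joint_product T)"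
  shows "multidegree c t = joint_degree T"
  using assms
proof (induction T arbitrary: t)
  case Nil
  then show ?case
    by (auto simp: joint_product_def joint_degree_def multidegree_def)
next
  case (Cons i T)
  from Cons.prems(2) obtain s s' where s: "s \<in> Poly_Mapping.keys (f i)"
      "s' \<in> Poly_Mapping.keys (joint_product T)" "t = s + s'"
    unfolding joint_product_Cons by (rule keys_mult_memE)
  moreover have "multidegree c s' = joint_degree T"
    using Cons s by simp
  ultimately show ?case
    using multidegree_f[OF s(1)] Cons.prems(1)
    by (auto simp: fun_eq_iff multidegree_add joint_degree_def)
qed

lemma joint_product_neq_0: "distinct T \<Longrightarrow> joint_product T \<noteq> 0"
proof (induction T)
  case Nil
  show ?case by (simp add: joint_product_def)
next
  case (Cons i T)
  then show ?case
    unfolding joint_product_Cons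
    by (intro mult_neq_0_if_colors_separate[where i = i and c = c])
      (auto simp: f_neq_0 multidegree_f multidegree_joint_product joint_degree_def)
qed

lemma \<epsilon>_linear: "linear_on_free (*) (\<beta> 0) \<epsilon>"
  and \<phi>_linear: "linear_on_free fscale (\<beta> (Suc p)) (\<phi> p)"
  and \<epsilon>_graded: "\<epsilon> ` free_module_part (\<beta> 0) e \<subseteq> homogeneous_part e"
  and \<phi>_graded: "\<phi> p ` free_module_part (\<beta> (Suc p)) e \<subseteq> free_module_part (\<beta> p) e"
  and \<epsilon>_image: "\<epsilon> ` free_module (\<beta> 0) = I"
  and exact_0: "\<phi> 0 ` free_module (\<beta> (Suc 0)) = {v \<in> free_module (\<beta> 0). \<epsilon> v = 0}"
  and exact_Suc: "\<phi> (Suc p) ` free_module (\<beta> (Suc (Suc p))) =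
      {v \<in> free_module (\<beta> (Suc p)). \<phi> p v = 0}"
  using resolution unfolding minimal_graded_free_resolution_def by auto

lemma \<phi>_in_free_module: "v \<in> free_module (\<beta> (Suc p)) \<Longrightarrow> \<phi> p v \<in> free_module (\<beta> p)"
  using exact_0 exact_Suc by (cases p) blast+

text \<open>Homological degree \<open>p\<close> of a chain map from the Koszul complex of \<open>f\<close> to the resolution:
  \<open>u xs\<close> is the image of the basis element of \<open>xs\<close>. The index is shifted because the Koszul complex
  has \<open>S\<close> in degree \<open>0\<close> while the resolution is one of \<open>I\<close>, so lists of length \<open>p + 1\<close> belong to
  \<open>F\<^sub>p\<close>. The second condition is what permits the next step.\<close>

definition koszul_lift :: "nat \<Rightarrow> ('c list \<Rightarrow> ('x, 'k) fvec) \<Rightarrow> bool"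
  where "koszul_lift p u \<longleftrightarrow>
    (\<forall>xs. length xs = Suc p \<longrightarrow> u xs \<in> free_module (\<beta> p)) \<and>
    (\<forall>xs. length xs = Suc (Suc p) \<longrightarrow> koszul fscale f u xs \<in> \<phi> p ` free_module (\<beta> (Suc p)))"

definition graded_cocycle :: "nat \<Rightarrow> ('x \<Rightarrow>\<^sub>0 nat) set \<Rightarrow> (('x, 'k) fvec \<Rightarrow> ('x, 'k) mpoly) \<Rightarrow> bool"
  where "graded_cocycle p M \<psi> \<longleftrightarrow>
    linear_on_free (*) (\<beta> p) \<psi> \<and>
    (\<forall>e. \<psi> ` free_module_part (\<beta> p) e \<subseteq> homogeneous_part e) \<and>
    (\<forall>v\<in>free_module (\<beta> p). Poly_Mapping.keys (\<psi> v) \<subseteq> M) \<and>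
    (\<forall>w\<in>free_module (\<beta> (Suc p)). \<psi> (\<phi> p w) = 0)"

text \<open>The choice \<open>u [i]\<close> over \<open>f i\<close> works because the boundary of the basis element of \<open>[i, j]\<close>
  maps to \<open>f i * f j - f j * f i = 0\<close> in \<open>I\<close>, so exactness at \<open>F\<^sub>0\<close> applies.\<close>

lemma koszul_lift_0:
  obtains u where "koszul_lift 0 u" and "\<And>i. \<epsilon> (u [i]) = f i"
proof -
  have "\<forall>i. \<exists>v. v \<in> free_module (\<beta> 0) \<and> \<epsilon> v = f i"
    using f_in_I \<epsilon>_image by (metis imageE)
  then obtain v where v: "\<And>i. v i \<in> free_module (\<beta> 0)" "\<And>i. \<epsilon> (v i) = f i"
    by metis
  define u where "u xs = v (hd xs)" for xs
  have "koszul fscale f u xs \<in> \<phi> 0 ` free_module (\<beta> (Suc 0))" if "length xs = 2" for xs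
  proof -
    have "\<epsilon> (koszul fscale f u xs) = koszul (*) f (\<lambda>ys. f (hd ys)) xs"
      by (subst koszul_linear_on_free[OF module_times \<epsilon>_linear]) (simp_all add: u_def v)
    also have "\<dots> = 0"
      using that by (auto simp: numeral_2_eq_2 length_Suc_conv)
    finally show ?thesis
      by (simp add: exact_0 koszul_in_free_module u_def v)
  qed
  then have "koszul_lift 0 u"
    by (auto simp: koszul_lift_def u_def v)
  then show ?thesis using that by (simp add: u_def v)
qed

text \<open>The usual comparison of a complex of free modules with an exact one: the square of the Koszul
  differential is zero, so exactness of the resolution makes the boundaries liftable again.\<close>

lemma koszul_lift_Suc:
  assumes u: "koszul_lift p u"
  obtains u' where "koszul_lift (Suc p) u'"
    and "\<And>xs. length xs = Suc (Suc p) \<Longrightarrow> \<phi> p (u' xs) = koszul fscale f u xs"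
proof -
  have "\<forall>xs. \<exists>v. length xs = Suc (Suc p) \<longrightarrow>
      v \<in> free_module (\<beta> (Suc p)) \<and> \<phi> p v = koszul fscale f u xs"
    using u unfolding koszul_lift_def by (metis imageE)
  then obtain u' where u': "\<And>xs. length xs = Suc (Suc p) \<Longrightarrow> u' xs \<in> free_module (\<beta> (Suc p))"
    "\<And>xs. length xs = Suc (Suc p) \<Longrightarrow> \<phi> p (u' xs) = koszul fscale f u xs"
    by metis
  have "koszul fscale f u' xs \<in> \<phi> (Suc p) ` free_module (\<beta> (Suc (Suc p)))"
    if xs: "length xs = Suc (Suc (Suc p))" for xs
  proof -
    have "\<phi> p (koszul fscale f u' xs) = koszul fscale f (\<lambda>ys. \<phi> p (u' ys)) xs"
      by (rule koszul_linear_on_free[OF module_fscale \<phi>_linear]) (simp add: u' xs)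
    also have "\<dots> = koszul fscale f (koszul fscale f u) xs"
      by (rule koszul_cong) (simp add: u' xs)
    also have "\<dots> = 0"
      by (rule koszul_koszul[OF module_fscale])
    finally have "\<phi> p (koszul fscale f u' xs) = 0" .
    moreover have "koszul fscale f u' xs \<in> free_module (\<beta> (Suc p))"
      by (rule koszul_in_free_module) (simp add: u' xs)
    ultimately show ?thesis
      by (simp add: exact_Suc)
  qed
  then show ?thesis using that[of u'] u' by (simp add: koszul_lift_def)
qed

lemma graded_cocycle_\<epsilon>: "graded_cocycle 0 (\<Union>i. exceeding c a i) \<epsilon>"
  unfolding graded_cocycle_def
proof (intro conjI allI ballI)
  show "Poly_Mapping.keys (\<epsilon> v) \<subseteq> (\<Union>i. exceeding c a i)" if "v \<in> free_module (\<beta> 0)" for v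
    using that \<epsilon>_image support_I by blast
  show "\<epsilon> (\<phi> 0 w) = 0" if "w \<in> free_module (\<beta> (Suc 0))" for w
    using that exact_0 by blast
qed (rule \<epsilon>_linear \<epsilon>_graded)+

text \<open>The connecting homomorphism of the Mayer-Vietoris sequence of \<open>P\<close> and \<open>N\<close>. As
  \<open>\<psi> \<circ> \<phi> p = 0\<close>, the maps \<open>\<alpha> \<circ> \<phi> p\<close> and \<open>(\<psi> - \<alpha>) \<circ> \<phi> p\<close> differ by a sign only; one has values
  in \<open>P\<close>, the other in \<open>N\<close>.\<close>

lemma graded_cocycle_connecting:
  assumes \<psi>: "graded_cocycle p (P \<union> N) \<psi>" and P: "upward_closed P" and N: "upward_closed N"
  obtains \<alpha> where "graded_cocycle (Suc p) (P \<inter> N) (\<alpha> \<circ> \<phi> p)"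
    and "linear_on_free (*) (\<beta> p) \<alpha>"
    and "\<And>v. v \<in> free_module (\<beta> p) \<Longrightarrow> Poly_Mapping.keys (\<alpha> v) \<subseteq> P"
    and "\<And>v. v \<in> free_module (\<beta> p) \<Longrightarrow> Poly_Mapping.keys (\<psi> v - \<alpha> v) \<subseteq> N"
proof -
  obtain \<alpha> where \<alpha>: "linear_on_free (*) (\<beta> p) \<alpha>"
    and deg: "\<And>e. \<alpha> ` free_module_part (\<beta> p) e \<subseteq> homogeneous_part e"
    and \<alpha>P: "\<And>v. v \<in> free_module (\<beta> p) \<Longrightarrow> Poly_Mapping.keys (\<alpha> v) \<subseteq> P"
    and \<alpha>N: "\<And>v. v \<in> free_module (\<beta> p) \<Longrightarrow> Poly_Mapping.keys (\<psi> v - \<alpha> v) \<subseteq> N"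
  proof (rule split_linear_map[of "\<beta> p" \<psi> P N])
  qed (use \<psi> P N in \<open>auto simp: graded_cocycle_def\<close>)
  have "graded_cocycle (Suc p) (P \<inter> N) (\<alpha> \<circ> \<phi> p)"
    unfolding graded_cocycle_def
  proof (intro conjI allI ballI)
    show "linear_on_free (*) (\<beta> (Suc p)) (\<alpha> \<circ> \<phi> p)"
      using linear_on_free_compose[OF \<phi>_linear \<alpha>] \<phi>_in_free_module by blast
    show "(\<alpha> \<circ> \<phi> p) ` free_module_part (\<beta> (Suc p)) e \<subseteq> homogeneous_part e" for e
      using \<phi>_graded[of p e] deg[of e] by auto
    fix w :: "('x, 'k) fvec" assume w: "w \<in> free_module (\<beta> (Suc p))"
    have "\<psi> (\<phi> p w) - \<alpha> (\<phi> p w) = - \<alpha> (\<phi> p w)"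
      using \<psi> w by (simp add: graded_cocycle_def)
    then show "Poly_Mapping.keys ((\<alpha> \<circ> \<phi> p) w) \<subseteq> P \<inter> N"
      using \<alpha>P[OF \<phi>_in_free_module[OF w]] \<alpha>N[OF \<phi>_in_free_module[OF w]] by simp
  next
    fix w :: "('x, 'k) fvec" assume "w \<in> free_module (\<beta> (Suc (Suc p)))"
    then have "\<phi> p (\<phi> (Suc p) w) = 0"
      using exact_Suc by blast
    then show "(\<alpha> \<circ> \<phi> p) (\<phi> (Suc p) w) = 0"
      by (simp add: linear_on_free_zero[OF module_times \<alpha>])
  qed
  then show ?thesis using that \<alpha> \<alpha>P \<alpha>N by blast
qed

text \<open>Each term \<open>\<plusminus> f x * g ys\<close> has degree \<open>> n x\<close> in color \<open>x\<close>, as \<open>f x\<close> contributes \<open>n x\<close> and \<open>g ys\<close>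
  more than \<open>a x\<close>. This exceeds the degree of \<open>b\<close> in that color.\<close>

lemma koszul_component_eq_0:
  assumes g: "\<And>ys. Suc (length ys) = length xs \<Longrightarrow>
      Poly_Mapping.keys (g ys) \<subseteq> (\<Inter>i\<in>A. exceeding c a i)"
    and "set xs \<subseteq> A" and b: "\<And>i. i \<in> A \<Longrightarrow> b i = n i"
  shows "multigraded_component c b (koszul (*) f g xs) = 0"
  using g \<open>set xs \<subseteq> A\<close>
proof (induction xs arbitrary: g)
  case Nil
  show ?case using multigraded_component_eq_0[of 0 c b] by simp
next
  case (Cons x xs)
  have "multigraded_component c b (f x * g xs) = 0"
  proof (rule multigraded_component_eq_0)
    fix t assume "t \<in> Poly_Mapping.keys (f x * g xs)"
    then obtain s s' where s: "s \<in> Poly_Mapping.keys (f x)" "s' \<in> Poly_Mapping.keys (g xs)"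
      "t = s + s'"
      by (rule keys_mult_memE)
    have "s' \<in> exceeding c a x"
      using Cons.prems(1)[of xs] Cons.prems(2) s(2) by auto
    then have "multidegree c t x > b x"
      using Cons.prems(2) b[of x] multidegree_f[OF s(1), of x]
      by (simp add: s(3) multidegree_add exceeding_def)
    then show "multidegree c t \<noteq> b" by auto
  qed
  moreover have "multigraded_component c b (koszul (*) f (\<lambda>ys. g (x # ys)) xs) = 0"
    using Cons.prems by (intro Cons.IH) auto
  ultimately show ?case
    by (simp add: multigraded_component_diff)
qed

text \<open>The invariant that keeps the cocycles from being zero. The component is taken in the color
  vector of the product on the right, and the new color \<open>i\<close> stands in front.\<close>

definition detects :: "'c list \<Rightarrow> (('x, 'k) fvec \<Rightarrow> ('x, 'k) mpoly) \<Rightarrow>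
    ('c list \<Rightarrow> ('x, 'k) fvec) \<Rightarrow> bool"
  where "detects T \<psi> u \<longleftrightarrow> (\<forall>i. i \<notin> set T \<longrightarrow>
    multigraded_component c (joint_degree (i # T)) (\<psi> (u (i # T))) = joint_product (i # T))"

text \<open>On \<open>u (j # T)\<close> the summand \<open>\<psi> - \<alpha>\<close> is invisible: its monomials involve a color outside
  \<open>j # T\<close>. So \<open>\<alpha>\<close> inherits the value of \<open>\<psi>\<close>. The boundary of the basis element of \<open>i # j # T\<close>
  consists of \<open>f i\<close> times the basis element of \<open>j # T\<close>, which gives the desired value, and of terms
  that omit a color \<open>x\<close> of \<open>j # T\<close>. These would have to get all of their degree in color \<open>x\<close> from
  \<open>f x\<close>, but \<open>\<alpha>\<close> has values in \<open>P\<^sub>x\<close>.\<close>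

lemma detects_connecting:
  assumes det: "detects T \<psi> u" and u: "koszul_lift (length T) u"
    and distinct: "distinct (j # T)"
    and \<alpha>: "linear_on_free (*) (\<beta> (length T)) \<alpha>"
    and \<alpha>P: "\<And>v. v \<in> free_module (\<beta> (length T)) \<Longrightarrow>
      Poly_Mapping.keys (\<alpha> v) \<subseteq> (\<Inter>i\<in>set (j # T). exceeding c a i)"
    and \<alpha>N: "\<And>v. v \<in> free_module (\<beta> (length T)) \<Longrightarrow>
      Poly_Mapping.keys (\<psi> v - \<alpha> v) \<subseteq> (\<Union>i\<in>- set (j # T). exceeding c a i)"
    and u': "\<And>xs. length xs = Suc (Suc (length T)) \<Longrightarrow>
      \<phi> (length T) (u' xs) = koszul fscale f u xs"
  shows "detects (j # T) (\<alpha> \<circ> \<phi> (length T)) u'"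
  unfolding detects_def
proof (intro allI impI)
  fix i assume i: "i \<notin> set (j # T)"
  have mem: "u xs \<in> free_module (\<beta> (length T))" if "length xs = Suc (length T)" for xs
    using u that by (simp add: koszul_lift_def)
  have "multigraded_component c (joint_degree (j # T)) (\<psi> (u (j # T)) - \<alpha> (u (j # T))) = 0"
  proof (rule multigraded_component_eq_0)
    fix t assume "t \<in> Poly_Mapping.keys (\<psi> (u (j # T)) - \<alpha> (u (j # T)))"
    then obtain k where "k \<notin> set (j # T)" "a k < multidegree c t k"
      using \<alpha>N[OF mem[of "j # T"]] by (auto simp: exceeding_def)
    then show "multidegree c t \<noteq> joint_degree (j # T)"
      by (auto simp: joint_degree_def)
  qed
  then have \<alpha>_jT: "multigraded_component c (joint_degree (j # T)) (\<alpha> (u (j # T))) =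
      joint_product (j # T)"
    using det distinct by (simp add: detects_def multigraded_component_diff)
  have "(\<alpha> \<circ> \<phi> (length T)) (u' (i # j # T)) = \<alpha> (koszul fscale f u (i # j # T))"
    by (simp add: u')
  also have "\<dots> = koszul (*) f (\<lambda>ys. \<alpha> (u ys)) (i # j # T)"
    by (rule koszul_linear_on_free[OF module_times \<alpha>]) (simp add: mem)
  also have "\<dots> = f i * \<alpha> (u (j # T)) - koszul (*) f (\<lambda>ys. \<alpha> (u (i # ys))) (j # T)"
    by (simp only: koszul.simps)
  also have "multigraded_component c (joint_degree (i # j # T)) \<dots> =
      multigraded_component c (joint_degree (i # j # T)) (f i * \<alpha> (u (j # T)))"
  proof -
    have "multigraded_component c (joint_degree (i # j # T))
        (koszul (*) f (\<lambda>ys. \<alpha> (u (i # ys))) (j # T)) = 0"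
      by (rule koszul_component_eq_0[where A = "set (j # T)"])
        (use \<alpha>P[OF mem] in \<open>auto simp: joint_degree_def\<close>)
    then show ?thesis
      by (simp only: multigraded_component_diff diff_zero)
  qed
  also have "\<dots> = f i * multigraded_component c (joint_degree (j # T)) (\<alpha> (u (j # T)))"
  proof (rule multigraded_component_mult)
    show "multidegree c t = joint_degree [i]" if "t \<in> Poly_Mapping.keys (f i)" for t
      using multidegree_f[OF that] by (auto simp: joint_degree_def)
    show "joint_degree (i # j # T) k = joint_degree [i] k + joint_degree (j # T) k" for k
      using i by (auto simp: joint_degree_def)
  qed
  finally show "multigraded_component c (joint_degree (i # j # T))
      ((\<alpha> \<circ> \<phi> (length T)) (u' (i # j # T))) = joint_product (i # j # T)"
    by (simp only: \<alpha>_jT joint_product_Cons)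
qed

text \<open>Passing from \<open>T\<close> to \<open>j # T\<close> moves \<open>j\<close> from the union to the intersection. The old ideal is
  \<open>Q \<inter> (P\<^sub>j + N) = Q \<inter> P\<^sub>j + Q \<inter> N\<close>, with \<open>Q\<close> the intersection over \<open>T\<close> and \<open>N\<close> the sum over the
  remaining colors, and the connecting homomorphism leads to \<open>Q \<inter> P\<^sub>j \<inter> N\<close>.\<close>

lemma detecting_cocycle_exists:
  assumes "distinct T"
  shows "\<exists>\<psi> u. graded_cocycle (length T)
      ((\<Inter>i\<in>set T. exceeding c a i) \<inter> (\<Union>i\<in>- set T. exceeding c a i)) \<psi> \<and>
    koszul_lift (length T) u \<and> detects T \<psi> u"
  using assms
proof (induction T)
  case Nil
  obtain u where u: "koszul_lift 0 u" "\<And>i. \<epsilon> (u [i]) = f i"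
    by (rule koszul_lift_0) blast
  have "detects [] \<epsilon> u"
    unfolding detects_def
  proof (intro allI impI)
    fix i
    show "multigraded_component c (joint_degree [i]) (\<epsilon> (u [i])) = joint_product [i]"
      unfolding u(2) joint_product_def
      by (subst multigraded_component_eq_self) (auto simp: multidegree_f joint_degree_def)
  qed
  then show ?case using u(1) graded_cocycle_\<epsilon> by auto
next
  case (Cons j T)
  then obtain \<psi> u where \<psi>: "graded_cocycle (length T)
      ((\<Inter>i\<in>set T. exceeding c a i) \<inter> (\<Union>i\<in>- set T. exceeding c a i)) \<psi>"
    and u: "koszul_lift (length T) u" and det: "detects T \<psi> u"
    by auto
  define P where "P = (\<Inter>i\<in>set (j # T). exceeding c a i)"
  define Q where "Q = (\<Inter>i\<in>set T. exceeding c a i)"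
  define N where "N = (\<Union>i\<in>- set (j # T). exceeding c a i)"
  have PN: "upward_closed P" "upward_closed (Q \<inter> N)"
    unfolding P_def Q_def N_def
    by (intro upward_closed_INT upward_closed_UN upward_closed_Int upward_closed_exceeding)+
  have "Q \<inter> (\<Union>i\<in>- set T. exceeding c a i) = P \<union> Q \<inter> N"
    using Cons.prems by (auto simp: P_def Q_def N_def)
  then have \<psi>': "graded_cocycle (length T) (P \<union> Q \<inter> N) \<psi>"
    using \<psi> by (simp add: Q_def)
  obtain \<alpha> where \<alpha>: "graded_cocycle (Suc (length T)) (P \<inter> (Q \<inter> N)) (\<alpha> \<circ> \<phi> (length T))"
    "linear_on_free (*) (\<beta> (length T)) \<alpha>"
    "\<And>v. v \<in> free_module (\<beta> (length T)) \<Longrightarrow> Poly_Mapping.keys (\<alpha> v) \<subseteq> P"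
    "\<And>v. v \<in> free_module (\<beta> (length T)) \<Longrightarrow> Poly_Mapping.keys (\<psi> v - \<alpha> v) \<subseteq> Q \<inter> N"
    by (rule graded_cocycle_connecting[OF \<psi>' PN]) blast
  obtain u' where u': "koszul_lift (Suc (length T)) u'"
    "\<And>xs. length xs = Suc (Suc (length T)) \<Longrightarrow> \<phi> (length T) (u' xs) = koszul fscale f u xs"
    by (rule koszul_lift_Suc[OF u]) blast
  have "detects (j # T) (\<alpha> \<circ> \<phi> (length T)) u'"
    using \<alpha>(3,4) unfolding P_def N_def
    by (intro detects_connecting[OF det u Cons.prems \<alpha>(2) _ _ u'(2)]) blast+
  moreover have "P \<inter> (Q \<inter> N) = P \<inter> N"
    by (auto simp: P_def Q_def)
  ultimately have "graded_cocycle (length (j # T)) (P \<inter> N) (\<alpha> \<circ> \<phi> (length T)) \<and>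
      koszul_lift (length (j # T)) u' \<and> detects (j # T) (\<alpha> \<circ> \<phi> (length T)) u'"
    using \<alpha>(1) u'(1) by simp
  then show ?case
    unfolding P_def N_def by blast
qed

text \<open>Let \<open>T\<close> contain all colors but one. The detecting cocycle on \<open>F\<^sub>p\<close>, \<open>p = r - 1\<close>, is nonzero, so
  it is nonzero on some basis vector. Its value there has the degree of the basis vector and lies in
  all \<open>P\<^sub>i\<close>, hence in degrees at least \<open>\<Sum>\<^sub>i (a\<^sub>i + 1)\<close>.\<close>

lemma generator_of_large_degree:
  "\<exists>p i. \<beta> p i \<noteq> 0 \<and> int (\<Sum>j\<in>UNIV. a j) + int p < i"
proof -
  obtain cs :: "'c list" where cs: "set cs = UNIV" "distinct cs"
    using finite_distinct_list[of "UNIV :: 'c set"] by auto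
  then obtain j T where jT: "cs = j # T"
    by (cases cs) auto
  have notin: "j \<notin> set T" and compl: "- set T = {j}" and "distinct T"
    using cs jT by auto
  define p where "p = length T"
  have card: "Suc p = card (UNIV :: 'c set)"
    using distinct_card[OF cs(2)] cs(1) jT by (simp add: p_def)
  obtain \<psi> u where \<psi>: "graded_cocycle p
      ((\<Inter>i\<in>set T. exceeding c a i) \<inter> (\<Union>i\<in>- set T. exceeding c a i)) \<psi>"
    and u: "koszul_lift p u" and det: "detects T \<psi> u"
    using detecting_cocycle_exists[OF \<open>distinct T\<close>] p_def by blast
  have "multigraded_component c (joint_degree cs) (\<psi> (u cs)) \<noteq> 0"
    using det notin joint_product_neq_0[OF cs(2)] by (simp add: detects_def jT)
  then have "\<psi> (u cs) \<noteq> 0"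
    using multigraded_component_eq_0[of 0 c "joint_degree cs"] by auto
  moreover have "u cs \<in> free_module (\<beta> p)"
    using u by (simp add: koszul_lift_def jT p_def)
  moreover have lin: "linear_on_free (*) (\<beta> p) \<psi>"
    using \<psi> by (simp add: graded_cocycle_def)
  ultimately obtain i k where k: "k < \<beta> p i" and nz: "\<psi> (Poly_Mapping.single (i, k) 1) \<noteq> 0"
    using linear_on_free_eq_0[OF lin, of "u cs"] by auto
  obtain t where t: "t \<in> Poly_Mapping.keys (\<psi> (Poly_Mapping.single (i, k) 1))"
    using nz by (metis all_not_in_conv keys_eq_empty)
  have "\<psi> (Poly_Mapping.single (i, k) 1) \<in> \<psi> ` free_module_part (\<beta> p) i"
    by (intro imageI single_in_free_module_part k)
  then have "\<psi> (Poly_Mapping.single (i, k) 1) \<in> homogeneous_part i"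
    using \<psi> unfolding graded_cocycle_def by blast
  then have "int (total_degree t) = i"
    using t by (simp add: homogeneous_part_def)
  have "Poly_Mapping.keys (\<psi> (Poly_Mapping.single (i, k) 1)) \<subseteq>
      (\<Inter>i\<in>set T. exceeding c a i) \<inter> exceeding c a j"
    using \<psi> free_module_single[of k "\<beta> p" i "1 :: ('x, 'k) mpoly", OF k]
    by (simp add: graded_cocycle_def compl)
  with t have t_all: "t \<in> (\<Inter>i\<in>set T. exceeding c a i) \<inter> exceeding c a j"
    by blast
  have "Suc (a l) \<le> multidegree c t l" for l
  proof -
    have "l \<in> set T \<or> l = j"
      using compl by blast
    with t_all show ?thesis by (auto simp: exceeding_def Suc_le_eq)
  qed
  then have "(\<Sum>l\<in>UNIV. Suc (a l)) \<le> total_degree t"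
    unfolding total_degree_eq_sum_multidegree[of t c] by (rule sum_mono)
  \<comment> \<open>Each of the \<open>r = p + 1\<close> colors contributes one more than \<open>a l\<close>.\<close>
  then have "(\<Sum>l\<in>UNIV. a l) + Suc p \<le> total_degree t"
    by (simp only: sum_Suc card)
  then have "int (\<Sum>l\<in>UNIV. a l) + int p < i"
    unfolding \<open>int (total_degree t) = i\<close>[symmetric] of_nat_add[symmetric] of_nat_less_iff by simp
  moreover have "\<beta> p i \<noteq> 0"
    using k by simp
  ultimately show ?thesis by blast
qed

end

theorem theorem4p1:
  fixes c :: "'x::finite \<Rightarrow> 'c::finite"
    and d :: int
    and I :: "('x, 'k::field) mpoly set"
    and a :: "'c \<Rightarrow> nat"
  assumes "multihomogeneous_ideal c I"
    and "regular_ideal (d + 1) I"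
    and "\<And>i. \<exists>f\<in>I. has_pure_color c f i"
    and "int (\<Sum>i\<in>UNIV. a i) = d + 1"
  shows "\<exists>f\<in>I. has_color_vector c f a"
proof (rule ccontr)
  assume none: "\<not> (\<exists>f\<in>I. has_color_vector c f a)"
  have "\<forall>i. \<exists>f n. f \<in> I \<and> n > 0 \<and> has_color_vector c f (\<lambda>j. if j = i then n else 0)"
    using assms(3) unfolding has_pure_color_def by blast
  then obtain f n where f: "\<And>i. f i \<in> I" and n: "\<And>i. n i > (0::nat)"
    and fn: "\<And>i. has_color_vector c (f i) (\<lambda>j. if j = i then n i else 0)"
    by metis
  \<comment> \<open>Elements of pure color \<open>i\<close> have positive degree, so the color \<open>i\<close> occurs.\<close>
  have "\<exists>x. c x = i" for i
  proof (rule ccontr)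
    assume "\<nexists>x. c x = i"
    then have "multidegree c t i = 0" for t
      by (simp add: multidegree_def)
    moreover obtain t where "t \<in> Poly_Mapping.keys (f i)"
      using fn[of i] by (metis has_color_vector_def all_not_in_conv keys_eq_empty)
    moreover from this have "multidegree c t i = n i"
      using fn[of i] by (auto simp: has_color_vector_def)
    ultimately show False
      using n[of i] by simp
  qed
  then have "surj c" by (metis surjI)
  obtain \<beta> \<epsilon> \<phi> where res: "minimal_graded_free_resolution I \<beta> \<epsilon> \<phi>"
    and reg: "\<And>p i. \<beta> p i \<noteq> 0 \<Longrightarrow> i \<le> d + 1 + int p"
    using assms(2) unfolding regular_ideal_def by blast
  interpret colored_resolution c a I \<beta> \<epsilon> \<phi> f n
  proof
    show "Poly_Mapping.keys g \<subseteq> (\<Union>i. exceeding c a i)" if "g \<in> I" for g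
      by (rule ideal_support_exceeds[OF assms(1) \<open>surj c\<close> none that])
  qed (use res f fn in \<open>auto simp: has_color_vector_def\<close>)
  show False
    using generator_of_large_degree reg assms(4) by (metis not_less)
qed

end
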